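(* Let $\mathbf{A}$ be a family of compact subsets of $\mathbf{E}$ which is closed under taking arbitrary intersections and satisfies $\varnothing,\mathbf{E}\in\mathbf{A}$. For known intensity $\lambda>0$, the wrapping hull $\hat A$ is a complete and sufficient statistic in the Poisson point process model of intensity $\lambda$ with parameter class $\mathbf{A}$.
   Context: $\mathbf{E}\subset\mathbb{R}^d$ is a fixed convex compact set (e.g. $[0,1]^d$), and $|\cdot|$ denotes Lebesgue measure. A Poisson point process $\mathcal{N}$ of intensity $\lambda>0$ on $A\in\mathbf{A}$ is a point process on $\mathbf{E}$ such that $\mathcal{N}(B)\sim\mathrm{Poiss}(\lambda|A\cap B|)$ for every Borel set $B\subseteq\mathbf{E}$, and $\mathcal{N}(B_1),\dots,\mathcal{N}(B_n)$ are independent for mutually disjoint Borel sets $B_1,\dots,B_n$. Equivalently, one observes $N\sim\mathrm{Poiss}(\lambda|A|)$ points $X_1,\dots,X_N$ which are i.i.d. uniform on $A$ and independent of $N$. The law of the process is denoted $\mathbb{P}_A$, with expectation $\mathbb{E}_A$; the statistical model is $(\mathbb{P}_A)_{A\in\mathbf{A}}$ with $\lambda$ fixed and known. The ($\mathbf{A}$-)wrapping hull of the points is $$\hat A=\bigcap\{B\in\mathbf{A}: X_i\in B\ \text{ for all } i=1,\dots,N\},$$ a random element of $\mathbf{A}$, where $\mathbf{A}$ is equipped with the $\sigma$-algebra $\mathcal{A}=\sigma([B],\,B\in\mathbf{A})$, $[B]=\{A\in\mathbf{A}:A\subseteq B\}$. Completeness of $\hat A$ means: for every $\mathcal{A}$-measurable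 function $T:\mathbf{A}\to\mathbb{R}$, if $\mathbb{E}_A[T(\hat A)]=0$ for all $A\in\mathbf{A}$, then $T(\hat A)=0$ $\mathbb{P}_{\mathbf{E}}$-almost surely (note that every $\mathbb{P}_A$ is absolutely continuous with respect to $\mathbb{P}_{\mathbf{E}}$). *)

theory Defs
  imports "HOL-Probability.Probability" "HOL-Library.Multiset"
begin

section \<open>Poisson point processes\<close>

text \<open>
  A realisation of a point process on the compact set \<open>E\<close> is a finite integer-valued measure,
  encoded as the finite multiset of its points; \<open>point_count B \<omega>\<close> is the value of this measure on \<open>B\<close>.
\<close>

definition point_count :: "'a set \<Rightarrow> 'a multiset \<Rightarrow> nat" where
  "point_count B \<omega> = size {#x \<in># \<omega>. x \<in> B#}"

definition point_configurations :: "'a set \<Rightarrow> 'a multiset set" where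
  "point_configurations E = {\<omega>. set_mset \<omega> \<subseteq> E}"

definition configuration_space :: "'a::topological_space set \<Rightarrow> 'a multiset measure" where
  "configuration_space E = sigma (point_configurations E)
     {{\<omega> \<in> point_configurations E. point_count B \<omega> = k} | B k. B \<in> sets borel \<and> B \<subseteq> E}"

text \<open>
  The Poisson probabilities are written out because \<^const>\<open>poisson_pmf\<close> is only specified
  for a positive rate, whereas null sets \<open>A \<inter> B\<close> have to be covered;
  for rate \<open>0\<close> the formula gives the point mass at \<open>0\<close>, as \<open>0 ^ 0 = 1\<close>.
\<close>

definition poisson_process_law ::
    "'a::euclidean_space set \<Rightarrow> real \<Rightarrow> 'a set \<Rightarrow> 'a multiset measure \<Rightarrow> bool" where
  "poisson_process_law E lam A P \<longleftrightarrow>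
     prob_space P \<and>
     space P = space (configuration_space E) \<and>
     sets P = sets (configuration_space E) \<and>
     (\<forall>B k. B \<in> sets borel \<and> B \<subseteq> E \<longrightarrow>
        measure P {\<omega> \<in> space P. point_count B \<omega> = k} =
          (lam * measure lborel (A \<inter> B)) ^ k / fact k * exp (- (lam * measure lborel (A \<inter> B)))) \<and>
     (\<forall>(n::nat) B. (\<forall>i<n. B i \<in> sets borel \<and> B i \<subseteq> E) \<and> disjoint_family_on B {..<n} \<longrightarrow>
        prob_space.indep_vars P (\<lambda>_. count_space UNIV) (\<lambda>i. point_count (B i)) {..<n})"

section \<open>The wrapping hull\<close>

definition wrapping_hull :: "'a set set \<Rightarrow> 'a multiset \<Rightarrow> 'a set" where
  "wrapping_hull \<A> \<omega> = \<Inter>{B \<in> \<A>. set_mset \<omega> \<subseteq> B}"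

definition family_algebra :: "'a set set \<Rightarrow> 'a set measure" where
  "family_algebra \<A> = sigma \<A> {{A \<in> \<A>. A \<subseteq> B} | B. B \<in> \<A>}"

section \<open>Sufficiency and completeness\<close>

text \<open>
  Sufficiency of a statistic \<open>S\<close> with values in \<open>Y\<close> for the model \<open>(P \<theta>)\<close>, \<open>\<theta> \<in> \<Theta>\<close>, on the
  sample space \<open>X\<close>: the conditional probability of each event given \<open>S\<close> has a version
  that does not depend on the parameter. Conditioning on \<open>S\<close> is conditioning on the
  \<open>\<sigma>\<close>-algebra generated by \<open>S\<close>.
\<close>

definition sufficient_statistic ::
    "'i set \<Rightarrow> ('i \<Rightarrow> 'x measure) \<Rightarrow> 'x measure \<Rightarrow> 'y measure \<Rightarrow> ('x \<Rightarrow> 'y) \<Rightarrow> bool" where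
  "sufficient_statistic \<Theta> P X Y S \<longleftrightarrow>
     S \<in> X \<rightarrow>\<^sub>M Y \<and>
     (\<forall>F \<in> sets X. \<exists>g \<in> borel_measurable Y. \<forall>\<theta> \<in> \<Theta>.
        AE \<omega> in P \<theta>. real_cond_exp (P \<theta>) (vimage_algebra (space X) S Y) (indicator F) \<omega> = g (S \<omega>))"

text \<open>
  Integrability is an explicit hypothesis because the Bochner integral of a
  non-integrable function is \<open>0\<close> by convention.
\<close>

definition complete_hull ::
    "'a set \<Rightarrow> 'a set set \<Rightarrow> ('a set \<Rightarrow> 'a multiset measure) \<Rightarrow> bool" where
  "complete_hull E \<A> P \<longleftrightarrow>
     (\<forall>T \<in> borel_measurable (family_algebra \<A>).
        (\<forall>A \<in> \<A>. integrable (P A) (\<lambda>\<omega>. T (wrapping_hull \<A> \<omega>)) \<and>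
           integral\<^sup>L (P A) (\<lambda>\<omega>. T (wrapping_hull \<A> \<omega>)) = (0::real)) \<longrightarrow>
        (AE \<omega> in P E. T (wrapping_hull \<A> \<omega>) = 0))"

end

(* The finite-dimensional count probabilities on disjoint Borel sets determine a law on the
   configuration space, and restricting the Poisson process on E to {no point in E - A} yields, up to
   the normalising constant, the process on A. Hence dP_A/dP_E = exp(lam |E - A|) 1[hull \<subseteq> A],
   a function of the hull, and sufficiency follows by factorization. For completeness, the vanishing
   of E_A[T(hull)] says that T has integral 0 over {hull \<subseteq> A} under P_E. These sets are closed
   under intersection and generate the sigma-algebra, so T(hull) = 0 almost surely. *)

theory Submission
  imports Defs
begin

section \<open>Counts of points, and uniqueness of a law with given counts on disjoint sets\<close>

section \<open>Laws on the configuration space\<close>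

lemma point_count_eq_0_iff: "point_count B \<omega> = 0 \<longleftrightarrow> set_mset \<omega> \<inter> B = {}"
  by (auto simp: point_count_def filter_mset_eq_conv)

lemma point_count_Int:
  assumes "set_mset \<omega> \<subseteq> A"
  shows "point_count (B \<inter> A) \<omega> = point_count B \<omega>"
  using assms unfolding point_count_def by (intro arg_cong[where f=size] filter_mset_cong) auto

lemma point_count_Un:
  assumes "A \<inter> B = {}"
  shows "point_count (A \<union> B) \<omega> = point_count A \<omega> + point_count B \<omega>"
  using assms by (induction \<omega>) (auto simp: point_count_def)

lemma point_count_UN:
  assumes "finite J" "disjoint_family_on B J"
  shows "point_count (\<Union>j\<in>J. B j) \<omega> = (\<Sum>j\<in>J. point_count (B j) \<omega>)"
  using assms
proof (induction J)
  case empty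
  then show ?case by (simp add: point_count_def)
next
  case (insert j J)
  have "B j \<inter> (\<Union>i\<in>J. B i) = {}"
    using insert.hyps insert.prems by (auto simp: disjoint_family_on_def)
  moreover have "disjoint_family_on B J"
    using insert.prems by (auto simp: disjoint_family_on_def)
  ultimately show ?case
    using insert by (simp add: point_count_Un)
qed

lemma space_configuration_space [simp]: "space (configuration_space E) = point_configurations E"
  by (simp add: configuration_space_def space_measure_of_conv)

lemma sets_configuration_space:
  "sets (configuration_space E) = sigma_sets (point_configurations E)
     {{\<omega> \<in> point_configurations E. point_count B \<omega> = k} | B k. B \<in> sets borel \<and> B \<subseteq> E}"
  unfolding configuration_space_def by (intro sets_measure_of) auto

lemma sets_point_count_eq:
  assumes "B \<in> sets borel" "B \<subseteq> E"
  shows "{\<omega> \<in> point_configurations E. point_count B \<omega> = k} \<in> sets (configuration_space E)"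
  unfolding sets_configuration_space using assms by (intro sigma_sets.Basic) blast

text \<open>The cells are the atoms of the Boolean algebra that the finite family generates in
  \<open>E\<close>. They are needed because a Poisson law prescribes joint counts on disjoint sets
  only, while count events may involve overlapping ones.\<close>

lemma finite_borel_partition:
  fixes \<B> :: "'a::topological_space set set"
  assumes "finite \<B>" "\<B> \<subseteq> sets borel" "\<And>B. B \<in> \<B> \<Longrightarrow> B \<subseteq> E" "E \<in> sets borel"
  obtains n :: nat and D :: "nat \<Rightarrow> 'a set"
  where "\<And>i. i < n \<Longrightarrow> D i \<in> sets borel \<and> D i \<subseteq> E" "disjoint_family_on D {..<n}"
    "\<And>B. B \<in> \<B> \<Longrightarrow> \<exists>J\<subseteq>{..<n}. B = (\<Union>j\<in>J. D j)"
proof -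
  \<comment> \<open>\<open>C J\<close> is the atom of the points that lie in exactly the members
    \<open>J\<close> of the family, and \<open>e\<close> numbers all these patterns. An atom may be
    empty.\<close>
  define C where "C J = {x\<in>E. {B\<in>\<B>. x \<in> B} = J}" for J
  define n where "n = card (Pow \<B>)"
  obtain e where e: "bij_betw e {..<n} (Pow \<B>)"
    using ex_bij_betw_nat_finite[of "Pow \<B>"] assms(1) by (auto simp: n_def atLeast0LessThan)
  show ?thesis
  proof
    fix i assume i: "i < n"
    have eq: "C (e i) = {x \<in> E. \<forall>B\<in>\<B>. (x \<in> B) = (B \<in> e i)}"
      using bij_betwE[OF e] i by (auto simp: C_def)
    have "{x \<in> space borel. \<forall>B\<in>\<B>. (x \<in> B) = (B \<in> e i)} \<in> sets borel"
    proof (rule sets.sets_Collect_finite_All)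
      fix B assume "B \<in> \<B>"
      then have "B \<in> sets borel" "- B \<in> sets borel" using assms(2) borel_comp by blast+
      moreover have "{x \<in> space borel. (x \<in> B) = (B \<in> e i)} = (if B \<in> e i then B else - B)"
        by (rule set_eqI) simp
      ultimately show "{x \<in> space borel. (x \<in> B) = (B \<in> e i)} \<in> sets borel" by simp
    qed fact
    from sets.Int[OF assms(4) this]
    have "C (e i) \<in> sets borel"
      by (rule back_subst[of "\<lambda>X. X \<in> sets borel"]) (unfold eq, rule set_eqI, simp)
    moreover have "C (e i) \<subseteq> E" by (auto simp: C_def)
    ultimately show "C (e i) \<in> sets borel \<and> C (e i) \<subseteq> E" ..
  next
    show "disjoint_family_on (\<lambda>i. C (e i)) {..<n}"
      using e by (auto simp: disjoint_family_on_def C_def bij_betw_def inj_on_def)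
  next
    fix B assume B: "B \<in> \<B>"
    \<comment> \<open>\<open>B\<close> is the union of the atoms whose pattern contains it.\<close>
    have "B = (\<Union>j\<in>{j\<in>{..<n}. B \<in> e j}. C (e j))"
    proof safe
      fix x assume x: "x \<in> B"
      then have "{B\<in>\<B>. x \<in> B} \<in> Pow \<B>" by auto
      then have "{B\<in>\<B>. x \<in> B} \<in> e ` {..<n}"
        using e by (simp add: bij_betw_def)
      then obtain j where j: "j < n" "e j = {B\<in>\<B>. x \<in> B}"
        by (metis (no_types, lifting) imageE lessThan_iff)
      moreover have "x \<in> C (e j)"
        using x B assms(3)[OF B] by (auto simp: C_def j)
      ultimately show "x \<in> (\<Union>j\<in>{j\<in>{..<n}. B \<in> e j}. C (e j))"
        using x B by (intro UN_I[of j]) simp_all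
    qed (auto simp: C_def)
    then show "\<exists>J\<subseteq>{..<n}. B = (\<Union>j\<in>J. C (e j))"
      by (intro exI[of _ "{j\<in>{..<n}. B \<in> e j}"]) auto
  qed
qed

text \<open>Finite conjunctions of count conditions form an intersection-stable generator. After
  refining the sets involved to disjoint cells, each count is a sum of cell counts, so such an event
  depends only on the vector of cell counts, whose law is the same under \<open>M\<close> and
  \<open>N\<close> by hypothesis.\<close>

lemma configuration_measure_eqI:
  fixes E :: "'a::topological_space set"
  assumes sM: "sets M = sets (configuration_space E)" and sN: "sets N = sets (configuration_space E)"
    and fin: "finite_measure M" and E: "E \<in> sets borel"
    and eq: "\<And>n B k. (\<And>i. i < n \<Longrightarrow> B i \<in> sets borel \<and> B i \<subseteq> E) \<Longrightarrow> disjoint_family_on B {..<n::nat} \<Longrightarrow>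
      emeasure M {\<omega> \<in> point_configurations E. \<forall>i<n. point_count (B i) \<omega> = k i} =
      emeasure N {\<omega> \<in> point_configurations E. \<forall>i<n. point_count (B i) \<omega> = k i}"
  shows "M = N"
proof -
  let ?\<Omega> = "point_configurations E"
  \<comment> \<open>Indexing the events by finite sets of pairs (set, count) turns intersection into
    union of indices, and the empty index gives the whole space. Contradictory conditions on one set
    are allowed and give the empty event.\<close>
  define ev where "ev I = {\<omega> \<in> ?\<Omega>. \<forall>p\<in>I. point_count (fst p) \<omega> = snd p}" for I :: "('a set \<times> nat) set"
  define \<I> where "\<I> = {I :: ('a set \<times> nat) set. finite I \<and> (\<forall>p\<in>I. fst p \<in> sets borel \<and> fst p \<subseteq> E)}"
  have spM: "space M = ?\<Omega>" "space N = ?\<Omega>"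
    using sets_eq_imp_space_eq[OF sM] sets_eq_imp_space_eq[OF sN] by simp_all
  have ev_sets: "ev I \<in> sets (configuration_space E)" if "I \<in> \<I>" for I
  proof -
    have "{\<omega> \<in> space (configuration_space E). \<forall>p\<in>I. point_count (fst p) \<omega> = snd p} \<in>
        sets (configuration_space E)"
    proof (intro sets.sets_Collect_finite_All)
      fix p assume "p \<in> I"
      then have "fst p \<in> sets borel" "fst p \<subseteq> E"
        using that by (auto simp: \<I>_def)
      then show "{\<omega> \<in> space (configuration_space E). point_count (fst p) \<omega> = snd p} \<in>
          sets (configuration_space E)"
        by (simp add: sets_point_count_eq)
    qed (use that in \<open>auto simp: \<I>_def\<close>)
    then show ?thesis by (simp add: ev_def)
  qed
  have gen: "sets (configuration_space E) = sigma_sets ?\<Omega> (ev ` \<I>)"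
  proof
    show "sigma_sets ?\<Omega> (ev ` \<I>) \<subseteq> sets (configuration_space E)"
      using ev_sets sets.sigma_sets_subset[of "ev ` \<I>" "configuration_space E"] by auto
    show "sets (configuration_space E) \<subseteq> sigma_sets ?\<Omega> (ev ` \<I>)"
      unfolding sets_configuration_space
    proof (intro sigma_sets_mono subsetI)
      fix X assume "X \<in> {{\<omega> \<in> ?\<Omega>. point_count B \<omega> = k} | B k. B \<in> sets borel \<and> B \<subseteq> E}"
      then obtain B k where "X = ev {(B,k)}" "{(B,k)} \<in> \<I>"
        by (auto simp: ev_def \<I>_def)
      then show "X \<in> sigma_sets ?\<Omega> (ev ` \<I>)" by blast
    qed
  qed
  show ?thesis
  proof (rule measure_eqI_generator_eq[where E = "ev ` \<I>" and \<Omega> = ?\<Omega> and A = "\<lambda>_. ?\<Omega>"])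
    show "Int_stable (ev ` \<I>)"
    proof (rule Int_stableI_image)
      fix I J assume "I \<in> \<I>" "J \<in> \<I>"
      then show "\<exists>K\<in>\<I>. ev I \<inter> ev J = ev K"
        by (intro bexI[of _ "I \<union> J"]) (auto simp: ev_def \<I>_def ball_Un)
    qed
    show "ev ` \<I> \<subseteq> Pow ?\<Omega>" by (auto simp: ev_def)
    show "sets M = sigma_sets ?\<Omega> (ev ` \<I>)" "sets N = sigma_sets ?\<Omega> (ev ` \<I>)"
      using sM sN gen by auto
    have "ev {} = ?\<Omega>" "{} \<in> \<I>" by (auto simp: ev_def \<I>_def)
    then show "range (\<lambda>_. ?\<Omega>) \<subseteq> ev ` \<I>" by blast
    show "emeasure M ?\<Omega> \<noteq> \<infinity>" using fin by (simp add: finite_measure.emeasure_finite)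
    fix X assume "X \<in> ev ` \<I>"
    then obtain I where I: "I \<in> \<I>" "X = ev I" by auto
    obtain n D where D: "\<And>i. i < n \<Longrightarrow> D i \<in> sets borel \<and> D i \<subseteq> E" "disjoint_family_on D {..<n::nat}"
      and part: "\<And>B. B \<in> fst ` I \<Longrightarrow> \<exists>J\<subseteq>{..<n}. B = (\<Union>j\<in>J. D j)"
      by (rule finite_borel_partition[of "fst ` I" E]) (use I E in \<open>auto simp: \<I>_def\<close>)
    have "\<forall>B\<in>fst ` I. \<exists>J. J \<subseteq> {..<n} \<and> B = (\<Union>j\<in>J. D j)"
      using part by blast
    from bchoice[OF this] obtain J
      where "\<forall>B\<in>fst ` I. J B \<subseteq> {..<n} \<and> B = (\<Union>j\<in>J B. D j)" ..
    note J = this[THEN bspec, THEN conjunct1] this[THEN bspec, THEN conjunct2]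
    \<comment> \<open>The vector of cell counts is coded as a list, so that its values lie in the
      countable type \<open>nat list\<close>: measurability and equality of laws can then be checked
      on singletons.\<close>
    define c where "c \<omega> = map (\<lambda>i. point_count (D i) \<omega>) [0..<n]" for \<omega>
    have "c \<omega> = l \<longleftrightarrow> length l = n \<and> (\<forall>i<n. point_count (D i) \<omega> = l ! i)" for \<omega> l
      unfolding c_def list_eq_iff_nth_eq by auto
    then have c_vim: "c -` {l} \<inter> ?\<Omega> = (if length l = n
        then {\<omega> \<in> ?\<Omega>. \<forall>i<n. point_count (D i) \<omega> = l ! i} else {})" for l
      by auto
    have c_meas: "c \<in> configuration_space E \<rightarrow>\<^sub>M count_space UNIV"
    proof (subst measurable_count_space_eq_countable, safe)
      fix l
      have "{\<omega> \<in> ?\<Omega>. \<forall>i<n. point_count (D i) \<omega> = l ! i} = ev ((\<lambda>i. (D i, l ! i)) ` {..<n})"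
        by (auto simp: ev_def)
      moreover have "(\<lambda>i. (D i, l ! i)) ` {..<n} \<in> \<I>" using D by (auto simp: \<I>_def)
      ultimately show "c -` {l} \<inter> space (configuration_space E) \<in> sets (configuration_space E)"
        using ev_sets by (simp add: c_vim)
    qed auto
    then have cM: "c \<in> M \<rightarrow>\<^sub>M count_space UNIV" and cN: "c \<in> N \<rightarrow>\<^sub>M count_space UNIV"
      using sM sN by (simp_all cong: measurable_cong_sets)
    have distr: "distr M (count_space UNIV) c = distr N (count_space UNIV) c"
    proof (rule measure_eqI_countable)
      fix l :: "nat list"
      show "emeasure (distr M (count_space UNIV) c) {l} = emeasure (distr N (count_space UNIV) c) {l}"
        using eq[of n D "\<lambda>i. l ! i"] D
        by (simp add: emeasure_distr[OF cM] emeasure_distr[OF cN] spM c_vim)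
    qed auto
    \<comment> \<open>\<open>L\<close> holds the count vectors whose sums over the cells of each set
      in \<open>I\<close> take the prescribed values, so that \<open>X\<close> is the preimage of
      \<open>L\<close> under \<open>c\<close>.\<close>
    define L where "L = {l :: nat list. \<forall>p\<in>I. (\<Sum>j\<in>J (fst p). l ! j) = snd p}"
    have count: "point_count B \<omega> = (\<Sum>j\<in>J B. c \<omega> ! j)" if "B \<in> fst ` I" for B \<omega>
    proof -
      have "disjoint_family_on D (J B)"
        using D(2) J(1)[OF that] by (auto simp: disjoint_family_on_def)
      then have "point_count (\<Union>j\<in>J B. D j) \<omega> = (\<Sum>j\<in>J B. point_count (D j) \<omega>)"
        using finite_subset[OF J(1)[OF that]] by (intro point_count_UN) auto
      also have "\<dots> = (\<Sum>j\<in>J B. c \<omega> ! j)"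
        using J(1)[OF that] by (intro sum.cong) (auto simp: c_def)
      finally show ?thesis using J(2)[OF that] by simp
    qed
    have "X = c -` L \<inter> ?\<Omega>"
      using I count by (simp add: ev_def L_def Int_def conj_commute vimage_def)
    then show "emeasure M X = emeasure N X"
      using arg_cong[OF distr, of "\<lambda>Q. emeasure Q L"]
      by (simp add: emeasure_distr[OF cM] emeasure_distr[OF cN] spM)
  qed auto
qed

section \<open>The density of the process on \<open>A\<close> with respect to the process on
  \<open>E\<close>\<close>

section \<open>Change of the parameter\<close>

lemma poisson_process_joint:
  assumes P: "poisson_process_law E lam A P"
    and B: "\<And>i. i < (n::nat) \<Longrightarrow> B i \<in> sets borel \<and> B i \<subseteq> E" "disjoint_family_on B {..<n}"
  shows "measure P {\<omega> \<in> point_configurations E. \<forall>i<n. point_count (B i) \<omega> = k i} =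
    (\<Prod>i<n. (lam * measure lborel (A \<inter> B i)) ^ k i / fact (k i) * exp (- (lam * measure lborel (A \<inter> B i))))"
proof -
  interpret prob_space P using P by (simp add: poisson_process_law_def)
  have sp: "space P = point_configurations E" using P by (simp add: poisson_process_law_def)
  show ?thesis
  proof (cases "n = 0")
    \<comment> \<open>Without conditions the event is the whole space and the product is 1. This
      case is split off because an intersection over no indices would be \<open>UNIV\<close> and not
      the sample space.\<close>
    case True
    then show ?thesis using prob_space by (simp add: sp)
  next
    case False
    have "indep_vars (\<lambda>_. count_space UNIV) (\<lambda>i. point_count (B i)) {..<n}"
      using P B unfolding poisson_process_law_def by blast
    from indep_varsD_finite[OF this, of "\<lambda>i. {k i}"] False
    have "prob (\<Inter>i\<in>{..<n}. point_count (B i) -` {k i} \<inter> space P) =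
        (\<Prod>i<n. prob (point_count (B i) -` {k i} \<inter> space P))"
      by (simp add: lessThan_empty_iff)
    also have "(\<Inter>i\<in>{..<n}. point_count (B i) -` {k i} \<inter> space P) =
        {\<omega> \<in> point_configurations E. \<forall>i<n. point_count (B i) \<omega> = k i}"
      using False by (auto simp: sp)
    also have "(\<Prod>i<n. prob (point_count (B i) -` {k i} \<inter> space P)) =
        (\<Prod>i<n. (lam * measure lborel (A \<inter> B i)) ^ k i / fact (k i) * exp (- (lam * measure lborel (A \<inter> B i))))"
    proof (intro prod.cong refl)
      fix i assume "i \<in> {..<n}"
      then have "prob {\<omega> \<in> space P. point_count (B i) \<omega> = k i} =
          (lam * measure lborel (A \<inter> B i)) ^ k i / fact (k i) * exp (- (lam * measure lborel (A \<inter> B i)))"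
        using P B(1)[of i] unfolding poisson_process_law_def by blast
      moreover have "point_count (B i) -` {k i} \<inter> space P = {\<omega> \<in> space P. point_count (B i) \<omega> = k i}"
        by auto
      ultimately show "prob (point_count (B i) -` {k i} \<inter> space P) =
          (lam * measure lborel (A \<inter> B i)) ^ k i / fact (k i) * exp (- (lam * measure lborel (A \<inter> B i)))"
        by (simp only:)
    qed
    finally show ?thesis .
  qed
qed

text \<open>When no point falls into \<open>E - A\<close>, the counts on \<open>B i\<close> and on
  \<open>B i \<inter> A\<close> agree. Emptiness of \<open>E - A\<close> together with the counts on
  disjoint sets \<open>B i\<close> is therefore again a joint count event on disjoint sets. Under
  the law on \<open>E\<close> its probability factors into the probability under the law on
  \<open>A\<close> and the void probability of \<open>E - A\<close>.\<close>

lemma poisson_process_density: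
  assumes PE: "poisson_process_law E lam E PE" and PA: "poisson_process_law E lam A PA"
    and E: "E \<in> sets borel" and A: "A \<in> sets borel" "A \<subseteq> E"
  shows "PA = density PE (\<lambda>\<omega>. ennreal (exp (lam * measure lborel (E - A))) *
    indicator {\<omega> \<in> point_configurations E. set_mset \<omega> \<subseteq> A} \<omega>)"
proof -
  let ?\<Omega> = "point_configurations E"
  \<comment> \<open>The reciprocal of the probability, under \<open>PE\<close>, that
    \<open>E - A\<close> contains no point.\<close>
  define c where "c = exp (lam * measure lborel (E - A))"
  define V where "V = {\<omega> \<in> ?\<Omega>. set_mset \<omega> \<subseteq> A}"
  interpret PE: prob_space PE using PE by (simp add: poisson_process_law_def)
  interpret PA: prob_space PA using PA by (simp add: poisson_process_law_def)
  have sE: "sets PE = sets (configuration_space E)" and spE: "space PE = ?\<Omega>"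
    and sA: "sets PA = sets (configuration_space E)"
    using PE PA by (auto simp: poisson_process_law_def)
  have V_eq: "V = {\<omega> \<in> ?\<Omega>. point_count (E - A) \<omega> = 0}"
    by (auto simp: V_def point_count_eq_0_iff point_configurations_def)
  have V_sets: "V \<in> sets PE"
    using E A by (auto simp: V_eq sE intro!: sets_point_count_eq)
  let ?Q = "density PE (\<lambda>\<omega>. ennreal c * indicator V \<omega>)"
  have emQ: "emeasure ?Q X = ennreal (c * measure PE (V \<inter> X))" if "X \<in> sets PE" for X
    using that V_sets
    by (simp add: emeasure_density nn_integral_cmult mult.assoc indicator_inter_arith[symmetric]
        PE.emeasure_eq_measure ennreal_mult' c_def)
  have "PA = ?Q"
  proof (rule configuration_measure_eqI)
    show "sets PA = sets (configuration_space E)" "sets ?Q = sets (configuration_space E)"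
      using sA sE by auto
    show "finite_measure PA" by unfold_locales
    show "E \<in> sets borel" by fact
  next
    fix n and k :: "nat \<Rightarrow> nat" and B :: "nat \<Rightarrow> 'a set"
    assume B: "\<And>i. i < n \<Longrightarrow> B i \<in> sets borel \<and> B i \<subseteq> E" and disj: "disjoint_family_on B {..<n}"
    \<comment> \<open>The first \<open>n\<close> sets are cut down to \<open>A\<close>; index
      \<open>n\<close> carries the removed region, on which \<open>k'\<close> demands the count
      0.\<close>
    define B' where "B' i = (if i < n then B i \<inter> A else E - A)" for i
    define k' where "k' i = (if i < n then k i else 0)" for i
    have B'1: "B' i \<in> sets borel \<and> B' i \<subseteq> E" for i
      using A E B[of i] by (auto simp: B'_def)
    have B'2: "disjoint_family_on B' {..<Suc n}"
      using disj by (auto simp: disjoint_family_on_def B'_def)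
    let ?X = "{\<omega> \<in> ?\<Omega>. \<forall>i<n. point_count (B i) \<omega> = k i}"
    have X: "?X \<in> sets PE"
    proof -
      have "{\<omega> \<in> space PE. \<forall>i\<in>{..<n}. point_count (B i) \<omega> = k i} \<in> sets PE"
      proof (rule sets.sets_Collect_finite_All)
        fix i assume "i \<in> {..<n}"
        then show "{\<omega> \<in> space PE. point_count (B i) \<omega> = k i} \<in> sets PE"
          unfolding spE sE using B by (intro sets_point_count_eq) auto
      qed simp
      then show ?thesis by (simp only: spE Ball_def lessThan_iff)
    qed
    have VX: "V \<inter> ?X = {\<omega> \<in> ?\<Omega>. \<forall>i<Suc n. point_count (B' i) \<omega> = k' i}"
    proof -
      have "(\<forall>i<n. point_count (B i) \<omega> = k i) \<longleftrightarrow> (\<forall>i<n. point_count (B' i) \<omega> = k' i)"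
        if "\<omega> \<in> V" for \<omega>
        using that by (simp add: V_def B'_def k'_def point_count_Int)
      then show ?thesis
        unfolding less_Suc_eq by (fastforce simp: B'_def k'_def V_eq)
    qed
    show "emeasure PA ?X = emeasure ?Q ?X"
    proof -
      have Int: "E \<inter> (B i \<inter> A) = A \<inter> B i" "E \<inter> (E - A) = E - A" for i
        using A by auto
      have "measure PE (V \<inter> ?X) = (\<Prod>i<Suc n. (lam * measure lborel (E \<inter> B' i)) ^ k' i / fact (k' i) *
          exp (- (lam * measure lborel (E \<inter> B' i))))"
        unfolding VX by (rule poisson_process_joint[OF PE B'1 B'2])
      also have "\<dots> = (\<Prod>i<n. (lam * measure lborel (A \<inter> B i)) ^ k i / fact (k i) *
          exp (- (lam * measure lborel (A \<inter> B i)))) * exp (- (lam * measure lborel (E - A)))"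
        by (simp add: B'_def k'_def Int)
      also have "(\<Prod>i<n. (lam * measure lborel (A \<inter> B i)) ^ k i / fact (k i) *
          exp (- (lam * measure lborel (A \<inter> B i)))) = measure PA ?X"
        by (rule poisson_process_joint[OF PA B disj, symmetric])
      \<comment> \<open>The last factor of the product is the void probability, which
        \<open>c\<close> cancels.\<close>
      finally have "c * measure PE (V \<inter> ?X) = measure PA ?X"
        by (simp add: c_def exp_minus field_simps)
      then show ?thesis
        unfolding emQ[OF X] PA.emeasure_eq_measure by (simp only:)
    qed
  qed
  then show ?thesis by (simp add: c_def V_def)
qed


section \<open>A factorization criterion, and functions with vanishing integrals over a
  generator\<close>

section \<open>Sufficiency and completeness\<close>

text \<open>
  One direction of the Fisher--Neyman factorization theorem. The common version of the conditional
  probability of \<open>F\<close> is a Radon--Nikodym derivative on the space of values of the statistic;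
  the factor \<open>h \<theta> \<circ> S\<close> drops out because it is measurable with respect to the statistic.
\<close>

lemma sufficient_statistic_factorization:
  fixes h :: "'i \<Rightarrow> 'y \<Rightarrow> ennreal"
  assumes M: "finite_measure M" "sets M = sets X"
    and S: "S \<in> X \<rightarrow>\<^sub>M Y"
    and h: "\<And>\<theta>. \<theta> \<in> \<Theta> \<Longrightarrow> h \<theta> \<in> borel_measurable Y"
    and P: "\<And>\<theta>. \<theta> \<in> \<Theta> \<Longrightarrow> P \<theta> = density M (\<lambda>\<omega>. h \<theta> (S \<omega>))"
    and fin: "\<And>\<theta>. \<theta> \<in> \<Theta> \<Longrightarrow> finite_measure (P \<theta>)"
  shows "sufficient_statistic \<Theta> P X Y S"
  unfolding sufficient_statistic_def
proof (intro conjI ballI S)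
  fix F assume F: "F \<in> sets X"
  have SM[measurable]: "S \<in> M \<rightarrow>\<^sub>M Y" using S M(2) by (simp cong: measurable_cong_sets)
  have FM[measurable]: "F \<in> sets M" using F M(2) by simp
  have spM: "space M = space X" using sets_eq_imp_space_eq[OF M(2)] .
  interpret M: finite_measure M by fact
  \<comment> \<open>\<open>MS\<close> is the law of the statistic under \<open>M\<close>, and
    \<open>MF\<close> is the same for \<open>M\<close> restricted to \<open>F\<close>. The
    derivative of \<open>MF\<close> with respect to \<open>MS\<close> at \<open>y\<close> is the
    conditional probability of \<open>F\<close> given that the statistic equals
    \<open>y\<close>.\<close>
  define MS where "MS = distr M Y S"
  define MF where "MF = distr (density M (indicator F)) Y S"
  have SD: "S \<in> density M (indicator F) \<rightarrow>\<^sub>M Y" by simp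
  interpret MS: finite_measure MS unfolding MS_def by (rule M.finite_measure_distr) measurable
  have MF: "finite_measure MF" unfolding MF_def
  proof (rule finite_measure.finite_measure_distr[OF _ SD])
    show "finite_measure (density M (indicator F))"
      by (rule finite_measureI) (simp add: emeasure_density indicator_inter_arith[symmetric])
  qed
  have ac: "absolutely_continuous MS MF"
    unfolding absolutely_continuous_def
  proof
    fix B assume "B \<in> null_sets MS"
    then have B: "B \<in> sets Y" "emeasure M (S -` B \<inter> space M) = 0"
      by (auto simp: MS_def null_sets_def emeasure_distr)
    have SB: "S -` B \<inter> space M \<in> sets M" using B(1) by (rule measurable_sets[OF SM])
    have "AE \<omega> in M. \<omega> \<notin> S -` B \<inter> space M"
      using SB B(2) by (intro AE_not_in null_setsI)
    then have "AE \<omega> in M. indicator F \<omega> * indicator (S -` B \<inter> space M) \<omega> = (0::ennreal)"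
      by eventually_elim simp
    then have "emeasure (density M (indicator F)) (S -` B \<inter> space M) = 0"
      using SB by (simp add: emeasure_density nn_integral_0_iff_AE)
    then show "B \<in> null_sets MF"
      using B(1) by (simp add: MF_def null_sets_def emeasure_distr[OF SD])
  qed
  have sets_MF: "sets MF = sets MS" by (simp add: MF_def MS_def)
  define G where "G = RN_deriv MS MF"
  have G[measurable]: "G \<in> borel_measurable Y"
    unfolding G_def using borel_measurable_RN_deriv[of MS MF]
    by (simp add: MS_def cong: measurable_cong_sets)
  \<comment> \<open>The derivative is finite only almost everywhere, whereas a real-valued version
    is wanted everywhere; \<open>enn2real\<close> sends infinity to 0.\<close>
  define g where "g y = enn2real (G y)" for y
  have g[measurable]: "g \<in> borel_measurable Y" unfolding g_def by measurable
  have fin_G: "AE y in MS. G y = ennreal (g y)"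
  proof -
    have "AE y in MS. G y \<noteq> \<infinity>"
      unfolding G_def
      by (rule MS.RN_deriv_finite[OF finite_measure.axioms(1)[OF MF] ac sets_MF])
    then show ?thesis by eventually_elim (simp add: g_def less_top)
  qed
  \<comment> \<open>The defining property of conditional probability under \<open>M\<close>, for
    every nonnegative measurable weight \<open>k\<close> and not just for indicators, so that
    densities can be put into \<open>k\<close>.\<close>
  have key: "(\<integral>\<^sup>+\<omega>. indicator F \<omega> * k (S \<omega>) \<partial>M) = (\<integral>\<^sup>+\<omega>. ennreal (g (S \<omega>)) * k (S \<omega>) \<partial>M)"
    if k[measurable]: "k \<in> borel_measurable Y" for k :: "'y \<Rightarrow> ennreal"
  proof -
    have "(\<integral>\<^sup>+\<omega>. indicator F \<omega> * k (S \<omega>) \<partial>M) = (\<integral>\<^sup>+\<omega>. k (S \<omega>) \<partial>density M (indicator F))"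
      by (simp add: nn_integral_density)
    also have "\<dots> = integral\<^sup>N MF k"
      unfolding MF_def by (simp add: nn_integral_distr[OF SD])
    also have "\<dots> = (\<integral>\<^sup>+y. G y * k y \<partial>MS)"
      unfolding G_def by (rule MS.RN_deriv_nn_integral[OF ac sets_MF]) (simp add: MS_def)
    also have "\<dots> = (\<integral>\<^sup>+y. ennreal (g y) * k y \<partial>MS)"
      by (rule nn_integral_cong_AE) (use fin_G in \<open>eventually_elim, simp\<close>)
    also have "\<dots> = (\<integral>\<^sup>+\<omega>. ennreal (g (S \<omega>)) * k (S \<omega>) \<partial>M)"
      unfolding MS_def by (rule nn_integral_distr) measurable
    finally show ?thesis .
  qed
  show "\<exists>g\<in>borel_measurable Y. \<forall>\<theta>\<in>\<Theta>. AE \<omega> in P \<theta>.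
      real_cond_exp (P \<theta>) (vimage_algebra (space X) S Y) (indicator F) \<omega> = g (S \<omega>)"
  proof (intro bexI[of _ g] ballI g)
    fix \<theta> assume \<theta>: "\<theta> \<in> \<Theta>"
    let ?\<S> = "vimage_algebra (space X) S Y"
    have S_space: "S \<in> space X \<rightarrow> space Y" using measurable_space[OF S] by auto
    have sP: "sets (P \<theta>) = sets M" and spP: "space (P \<theta>) = space X"
      using P[OF \<theta>] spM by simp_all
    have SP[measurable]: "S \<in> P \<theta> \<rightarrow>\<^sub>M Y" using SM sP by (simp cong: measurable_cong_sets)
    have FP[measurable]: "F \<in> sets (P \<theta>)" using sP by simp
    note h[OF \<theta>, measurable]
    interpret P: finite_measure "P \<theta>" using fin[OF \<theta>] .
    have "subalgebra (P \<theta>) ?\<S>"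
      unfolding subalgebra_def using spP SP measurable_iff_sets[of S "P \<theta>" Y] by simp
    then interpret finite_measure_subalgebra "P \<theta>" ?\<S> by unfold_locales
    \<comment> \<open>Here the parameter disappears: the weight
      \<open>h \<theta> y * indicator B y\<close> turns the identity under \<open>M\<close> into one
      under \<open>P \<theta>\<close>, with the same \<open>g\<close>.\<close>
    have eq: "(\<integral>\<^sup>+\<omega>. indicator F \<omega> * indicator B (S \<omega>) \<partial>P \<theta>) =
        (\<integral>\<^sup>+\<omega>. ennreal (g (S \<omega>)) * indicator B (S \<omega>) \<partial>P \<theta>)" if [measurable]: "B \<in> sets Y" for B
      using key[of "\<lambda>y. h \<theta> y * indicator B y"]
      by (simp add: P[OF \<theta>] nn_integral_density ac_simps)
    show "AE \<omega> in P \<theta>. real_cond_exp (P \<theta>) ?\<S> (indicator F) \<omega> = g (S \<omega>)"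
    proof (rule real_cond_exp_charact)
      show "integrable (P \<theta>) (indicator F :: _ \<Rightarrow> real)"
        using FP by (simp add: P.emeasure_finite less_top[symmetric])
      \<comment> \<open>No pointwise bound on \<open>g\<close> is at hand. Taking
        \<open>B = space Y\<close> in \<open>eq\<close> bounds its integral by the total
        mass.\<close>
      show "integrable (P \<theta>) (\<lambda>\<omega>. g (S \<omega>))"
      proof (rule integrableI_nonneg)
        have "(\<integral>\<^sup>+\<omega>. ennreal (g (S \<omega>)) \<partial>P \<theta>) = (\<integral>\<^sup>+\<omega>. ennreal (g (S \<omega>)) * indicator (space Y) (S \<omega>) \<partial>P \<theta>)"
          using S_space by (intro nn_integral_cong) (auto simp: spP indicator_def)
        also have "\<dots> = (\<integral>\<^sup>+\<omega>. indicator F \<omega> * indicator (space Y) (S \<omega>) \<partial>P \<theta>)"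
          by (rule eq[symmetric]) simp
        also have "\<dots> \<le> (\<integral>\<^sup>+\<omega>. 1 \<partial>P \<theta>)"
          by (intro nn_integral_mono) (auto simp: indicator_def)
        also have "\<dots> < \<infinity>" using P.emeasure_finite by (simp add: less_top[symmetric])
        finally show "(\<integral>\<^sup>+\<omega>. ennreal (g (S \<omega>)) \<partial>P \<theta>) < \<infinity>" .
      qed (auto simp: g_def)
      show "(\<lambda>\<omega>. g (S \<omega>)) \<in> borel_measurable ?\<S>"
        by (rule measurable_compose[OF measurable_vimage_algebra1[OF S_space] g])
      fix A assume "A \<in> sets ?\<S>"
      then obtain B where B[measurable]: "B \<in> sets Y" and A: "A = S -` B \<inter> space X"
        by (auto simp: sets_vimage_algebra2[OF S_space])
      have A_sets[measurable]: "A \<in> sets (P \<theta>)"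
        unfolding A spP[symmetric] by measurable
      have set_int: "(LINT \<omega>:A|P \<theta>. u \<omega>) = enn2real (\<integral>\<^sup>+\<omega>. ennreal (u \<omega>) * indicator B (S \<omega>) \<partial>P \<theta>)"
        if [measurable]: "u \<in> borel_measurable (P \<theta>)" and "\<And>\<omega>. 0 \<le> u \<omega>" for u :: "_ \<Rightarrow> real"
      proof -
        have "(LINT \<omega>:A|P \<theta>. u \<omega>) = enn2real (\<integral>\<^sup>+\<omega>. ennreal (indicator A \<omega> *\<^sub>R u \<omega>) \<partial>P \<theta>)"
          unfolding set_lebesgue_integral_def using that(2) by (intro integral_eq_nn_integral) auto
        also have "\<dots> = enn2real (\<integral>\<^sup>+\<omega>. ennreal (u \<omega>) * indicator B (S \<omega>) \<partial>P \<theta>)"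
          by (intro arg_cong[where f=enn2real] nn_integral_cong) (auto simp: A spP indicator_def)
        finally show ?thesis .
      qed
      have "(LINT \<omega>:A|P \<theta>. indicator F \<omega>) = enn2real (\<integral>\<^sup>+\<omega>. indicator F \<omega> * indicator B (S \<omega>) \<partial>P \<theta>)"
        by (simp add: set_int ennreal_indicator)
      also have "\<dots> = enn2real (\<integral>\<^sup>+\<omega>. ennreal (g (S \<omega>)) * indicator B (S \<omega>) \<partial>P \<theta>)"
        using eq[OF B] by simp
      also have "\<dots> = (LINT \<omega>:A|P \<theta>. g (S \<omega>))"
        by (rule set_int[symmetric]) (simp_all add: g_def)
      finally show "(LINT \<omega>:A|P \<theta>. indicator F \<omega>) = (LINT \<omega>:A|P \<theta>. g (S \<omega>))" .
    qed
  qed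
qed

text \<open>Dynkin's argument: the sets over which \<open>f\<close> integrates to 0 are closed under
  countable disjoint unions, and under complements because the whole space is one of them. Hence
  they exhaust the sigma-algebra.\<close>

lemma AE_zero_if_integral_zero_on_generator:
  fixes f :: "'a \<Rightarrow> 'b::{banach, second_countable_topology}"
  assumes M: "finite_measure M" and f: "integrable M f"
    and G: "Int_stable G" "G \<subseteq> Pow (space M)" "sets M = sigma_sets (space M) G" "space M \<in> G"
    and zero: "\<And>B. B \<in> G \<Longrightarrow> (LINT x:B|M. f x) = 0"
  shows "AE x in M. f x = 0"
proof -
  interpret finite_measure M by fact
  have int: "set_integrable M A f" if "A \<in> sets M" for A
    unfolding set_integrable_def using that f by (rule integrable_mult_indicator)
  have "(LINT x:A|M. f x) = 0" if "A \<in> sets M" for A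
    using G(1,2) that[unfolded G(3)]
  proof (induction rule: sigma_sets_induct_disjoint)
    case (basic A)
    then show ?case by (rule zero)
  next
    case empty
    then show ?case by (simp add: set_lebesgue_integral_def)
  next
    case (compl A)
    then have A: "A \<in> sets M" by (simp only: G(3))
    have "(LINT x:A \<union> (space M - A)|M. f x) = (LINT x:A|M. f x) + (LINT x:space M - A|M. f x)"
      using A by (intro set_integral_Un int) auto
    moreover have "A \<union> (space M - A) = space M" using sets.sets_into_space[OF A] by auto
    ultimately show ?case using zero[OF G(4)] compl.IH by simp
  next
    case (union A)
    have A: "A i \<in> sets M" for i using union.hyps(2) by (auto simp only: G(3))
    have "(LINT x:(\<Union>i. A i)|M. f x) = (\<Sum>i. (LINT x:(A i)|M. f x))"
      using union.hyps(1) A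
      by (intro lebesgue_integral_countable_add int sets.countable_UN) (auto simp: disjoint_family_on_def)
    then show ?case using union.IH by simp
  qed
  then show ?thesis by (rule density_zero[OF f])
qed


section \<open>Measurability of the hull, and the proof of both properties\<close>

section \<open>The wrapping hull\<close>

text \<open>All points lie in each intersected set, hence in the hull; conversely, \<open>B\<close>
  is among the intersected sets once it contains the points. This translates hull events into void
  events.\<close>

lemma wrapping_hull_subset_iff:
  assumes "B \<in> \<A>"
  shows "wrapping_hull \<A> \<omega> \<subseteq> B \<longleftrightarrow> set_mset \<omega> \<subseteq> B"
  using assms unfolding wrapping_hull_def by blast

lemma space_family_algebra [simp]: "space (family_algebra \<A>) = \<A>"
  by (simp add: family_algebra_def space_measure_of_conv)

lemma sets_family_algebra:
  "sets (family_algebra \<A>) = sigma_sets \<A> {{A \<in> \<A>. A \<subseteq> B} | B. B \<in> \<A>}"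
  unfolding family_algebra_def by (intro sets_measure_of) auto

lemma Int_stable_lower_sets:
  assumes "\<And>A B. A \<in> \<A> \<Longrightarrow> B \<in> \<A> \<Longrightarrow> A \<inter> B \<in> \<A>"
  shows "Int_stable {{A \<in> \<A>. A \<subseteq> B} | B. B \<in> \<A>}"
proof (rule Int_stableI)
  fix X Y assume "X \<in> {{A \<in> \<A>. A \<subseteq> B} | B. B \<in> \<A>}" "Y \<in> {{A \<in> \<A>. A \<subseteq> B} | B. B \<in> \<A>}"
  then obtain B C where BC: "B \<in> \<A>" "C \<in> \<A>" "X = {A \<in> \<A>. A \<subseteq> B}" "Y = {A \<in> \<A>. A \<subseteq> C}"
    by blast
  then have "X \<inter> Y = {A \<in> \<A>. A \<subseteq> B \<inter> C}" by blast
  with assms[OF BC(1,2)] show "X \<inter> Y \<in> {{A \<in> \<A>. A \<subseteq> B} | B. B \<in> \<A>}" by blast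
qed

text \<open>The preimage of a generating lower set of \<open>B\<close> is the event that
  \<open>E - B\<close> is void. Since \<open>E\<close> contains every configuration, the
  intersection defining the hull is over a nonempty family and stays in \<open>\<A>\<close>.\<close>

lemma measurable_wrapping_hull:
  fixes E :: "'a::topological_space set"
  assumes E: "E \<in> \<A>"
    and Inter: "\<And>\<B>. \<B> \<subseteq> \<A> \<Longrightarrow> \<B> \<noteq> {} \<Longrightarrow> \<Inter>\<B> \<in> \<A>"
    and borel: "\<And>A. A \<in> \<A> \<Longrightarrow> A \<in> sets borel"
  shows "wrapping_hull \<A> \<in> configuration_space E \<rightarrow>\<^sub>M family_algebra \<A>"
proof (rule measurable_sigma_sets[OF sets_family_algebra])
  show "wrapping_hull \<A> \<in> space (configuration_space E) \<rightarrow> \<A>"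
    unfolding wrapping_hull_def using E by (auto simp: point_configurations_def intro!: Inter)
next
  fix X assume "X \<in> {{A \<in> \<A>. A \<subseteq> B} | B. B \<in> \<A>}"
  then obtain B where B: "B \<in> \<A>" "X = {A \<in> \<A>. A \<subseteq> B}" by blast
  have hull: "wrapping_hull \<A> \<omega> \<in> \<A>" if "\<omega> \<in> point_configurations E" for \<omega>
    unfolding wrapping_hull_def using E that by (intro Inter) (auto simp: point_configurations_def)
  have "wrapping_hull \<A> -` X \<inter> space (configuration_space E) =
      {\<omega> \<in> point_configurations E. point_count (E - B) \<omega> = 0}"
    using hull by (auto simp: B wrapping_hull_subset_iff point_count_eq_0_iff point_configurations_def)
  also have "\<dots> \<in> sets (configuration_space E)"
    using borel E B(1) by (intro sets_point_count_eq) auto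
  finally show "wrapping_hull \<A> -` X \<inter> space (configuration_space E) \<in> sets (configuration_space E)" .
qed auto

theorem theorem3p3:
  fixes E :: "'a::euclidean_space set"
    and \<A> :: "'a set set"
    and lam :: real
    and P :: "'a set \<Rightarrow> 'a multiset measure"
  assumes "convex E" and "compact E"
    and "\<And>A. A \<in> \<A> \<Longrightarrow> compact A \<and> A \<subseteq> E"
    and "\<And>\<B>. \<B> \<subseteq> \<A> \<Longrightarrow> \<B> \<noteq> {} \<Longrightarrow> \<Inter>\<B> \<in> \<A>"
    and "{} \<in> \<A>" and "E \<in> \<A>"
    and "lam > 0"
    and "\<And>A. A \<in> \<A> \<Longrightarrow> poisson_process_law E lam A (P A)"
  shows "sufficient_statistic \<A> P (configuration_space E) (family_algebra \<A>) (wrapping_hull \<A>)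
       \<and> complete_hull E \<A> P"
proof -
  let ?S = "wrapping_hull \<A>" and ?Y = "family_algebra \<A>"
  let ?G = "{{A \<in> \<A>. A \<subseteq> B} | B. B \<in> \<A>}"
  have borel: "A \<in> sets borel" if "A \<in> \<A>" for A
    using assms(3)[OF that] by (auto intro: borel_compact)
  have S: "?S \<in> configuration_space E \<rightarrow>\<^sub>M ?Y"
    using assms(6,4) borel by (rule measurable_wrapping_hull)
  have law: "prob_space (P A)" "sets (P A) = sets (configuration_space E)" if "A \<in> \<A>" for A
    using assms(8)[OF that] by (simp_all add: poisson_process_law_def)
  have spE: "space (P E) = point_configurations E"
    using sets_eq_imp_space_eq[OF law(2)[OF assms(6)]] by simp
  interpret PE: prob_space "P E" by (rule law(1)[OF assms(6)])
  have SE[measurable]: "?S \<in> P E \<rightarrow>\<^sub>M ?Y"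
    using S law(2)[OF assms(6)] by (simp cong: measurable_cong_sets)
  have hull: "?S \<omega> \<in> \<A>" if "\<omega> \<in> point_configurations E" for \<omega>
    using measurable_space[OF SE] that by (simp add: spE)
  \<comment> \<open>The density of \<open>P A\<close> with respect to \<open>P E\<close>, written as
    a function of the hull.\<close>
  define h where "h A B = exp (lam * measure lborel (E - A)) * indicat_real {B \<in> \<A>. B \<subseteq> A} B" for A B
  have lower[measurable]: "{B \<in> \<A>. B \<subseteq> A} \<in> sets ?Y" if "A \<in> \<A>" for A
    unfolding sets_family_algebra using that by (intro sigma_sets.Basic) blast
  have h: "h A \<in> borel_measurable ?Y" if "A \<in> \<A>" for A
    unfolding h_def using lower[OF that] by (intro borel_measurable_times borel_measurable_indicator) auto
  have hS: "(\<lambda>\<omega>. h A (?S \<omega>)) \<in> borel_measurable (P E)" if "A \<in> \<A>" for A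
    by (rule measurable_compose[OF SE h[OF that]])
  have dens: "P A = density (P E) (\<lambda>\<omega>. ennreal (h A (?S \<omega>)))" if A: "A \<in> \<A>" for A
  proof -
    let ?f = "\<lambda>\<omega>. ennreal (exp (lam * measure lborel (E - A))) *
      indicator {\<omega> \<in> point_configurations E. set_mset \<omega> \<subseteq> A} \<omega>"
    have eq: "?f \<omega> = ennreal (h A (?S \<omega>))" if "\<omega> \<in> space (P E)" for \<omega>
      using that hull[of \<omega>] wrapping_hull_subset_iff[OF A, of \<omega>]
      by (simp add: h_def spE indicator_def)
    have hS': "(\<lambda>\<omega>. ennreal (h A (?S \<omega>))) \<in> borel_measurable (P E)"
      using hS[OF A] by simp
    have "P A = density (P E) ?f"
      using assms(3)[OF A] by (intro poisson_process_density assms(8) assms(6) A borel) auto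
    also have "\<dots> = density (P E) (\<lambda>\<omega>. ennreal (h A (?S \<omega>)))"
      using hS' eq by (intro density_cong AE_I2) (simp_all cong: measurable_cong)
    finally show ?thesis .
  qed
  have "sufficient_statistic \<A> P (configuration_space E) ?Y ?S"
  proof (rule sufficient_statistic_factorization[OF _ law(2)[OF assms(6)] S _ dens])
    show "finite_measure (P E)" by unfold_locales
    show "(\<lambda>B. ennreal (h A B)) \<in> borel_measurable ?Y" if "A \<in> \<A>" for A
      using h[OF that] by simp
    show "finite_measure (P A)" if "A \<in> \<A>" for A
      using law(1)[OF that] by (rule prob_space.finite_measure)
  qed
  moreover have "complete_hull E \<A> P"
    unfolding complete_hull_def
  proof (intro ballI impI)
    fix T :: "'a set \<Rightarrow> real" assume T: "T \<in> borel_measurable ?Y"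
    assume T0: "\<forall>A\<in>\<A>. integrable (P A) (\<lambda>\<omega>. T (?S \<omega>)) \<and> (LINT \<omega>|P A. T (?S \<omega>)) = 0"
    have TS: "(\<lambda>\<omega>. T (?S \<omega>)) \<in> borel_measurable (P E)"
      by (rule measurable_compose[OF SE T])
    \<comment> \<open>The argument moves to the law of the hull on \<open>\<A>\<close>, whose
      sigma-algebra is generated by the lower sets. Integrability of \<open>T\<close> there is the
      hypothesis at \<open>A = E\<close>.\<close>
    have "AE B in distr (P E) ?Y ?S. T B = 0"
    proof (rule AE_zero_if_integral_zero_on_generator[where G = ?G])
      show "finite_measure (distr (P E) ?Y ?S)"
        by (rule PE.finite_measure_distr[OF SE])
      show "integrable (distr (P E) ?Y ?S) T"
        using T0 assms(6) by (simp add: integrable_distr_eq[OF SE T])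
      have "A \<inter> B \<in> \<A>" if "A \<in> \<A>" "B \<in> \<A>" for A B
        using assms(4)[of "{A, B}"] that by simp
      then show "Int_stable ?G" by (rule Int_stable_lower_sets)
      show "?G \<subseteq> Pow (space (distr (P E) ?Y ?S))" by auto
      show "sets (distr (P E) ?Y ?S) = sigma_sets (space (distr (P E) ?Y ?S)) ?G"
        by (simp add: sets_family_algebra)
      \<comment> \<open>\<open>E\<close> is the greatest member, so its lower set is the whole
        space, as the Dynkin argument requires.\<close>
      have "\<A> = {A \<in> \<A>. A \<subseteq> E}" using assms(3) by blast
      then show "space (distr (P E) ?Y ?S) \<in> ?G" using assms(6) by auto
      fix X assume "X \<in> ?G"
      then obtain A where A: "A \<in> \<A>" and X: "X = {B \<in> \<A>. B \<subseteq> A}" by blast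
      \<comment> \<open>Changing from \<open>P A\<close> to \<open>P E\<close> restricts the
        integral to hulls inside \<open>A\<close>, up to a positive constant that can be divided
        out.\<close>
      have "0 = (LINT \<omega>|P A. T (?S \<omega>))" using T0 A by simp
      also have "\<dots> = (LINT \<omega>|P E. h A (?S \<omega>) *\<^sub>R T (?S \<omega>))"
        unfolding dens[OF A] using TS hS[OF A] by (rule integral_density) (simp add: h_def)
      also have "\<dots> = exp (lam * measure lborel (E - A)) * (LINT \<omega>|P E. indicator X (?S \<omega>) *\<^sub>R T (?S \<omega>))"
        by (simp add: h_def X mult.assoc)
      also have "(LINT \<omega>|P E. indicator X (?S \<omega>) *\<^sub>R T (?S \<omega>)) = (LINT B:X|distr (P E) ?Y ?S. T B)"
        unfolding set_lebesgue_integral_def X using lower[OF A] T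
        by (intro integral_distr[symmetric] SE) simp
      finally show "(LINT B:X|distr (P E) ?Y ?S. T B) = 0" by simp
    qed
    then show "AE \<omega> in P E. T (?S \<omega>) = 0"
      by (rule AE_distrD[OF SE])
  qed
  ultimately show ?thesis ..
qed

end
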